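(* The implication "shear-free null geodesic congruence $\Rightarrow$ algebraically special" of the Goldberg-Sachs theorem fails in linearized gravity. Precisely: there exist a nonempty open subset $U\subset\mathbb{R}^4$, an open interval $I\ni 0$, a smooth one-parameter family of Lorentzian metrics $g_{ab}(\gamma)$, $\gamma\in I$, on $U$ with $g_{ab}(0)=\eta_{ab}$ the flat Minkowski metric, and a smooth nowhere vanishing ($\gamma$-independent) vector field $l^a$ on $U$, such that the following three conditions hold. (i) For every $\gamma\in I$, the vector field $l^a$ is null, geodesic and shear-free with respect to $g_{ab}(\gamma)$; that is, with $\nabla_a$ the Levi-Civita connection of $g_{ab}(\gamma)$ and $l_a=g_{ab}(\gamma)l^b$, $$l^a l^b g_{ab}(\gamma)=0,\qquad l^a\nabla_a l^b=\phi\, l^b,\qquad \nabla_{(a}l_{b)}=J_{(a}l_{b)}+\theta\, g_{ab}(\gamma)$$ for some scalar fields $\phi,\theta$ and some covector field $J_a$ on $U$ (which may depend on $\gamma$). (ii) The family satisfies the linearized vacuum Einstein equation: $R^{(1)}_{ab}=0$ on $U$. (iii) The vector field $l^a$ is not a degenerate eigendirection of the linearized Weyl tensor: the tensor field $$C^{(1)}_{abc[d}\,l_{e]}\,l^b l^c,$$ where $l_e=\eta_{ea}l^a$, is not identically zero on $U$.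
   Context: Abstract index notation is used; round and square brackets around indices denote symmetrization and antisymmetrization respectively. For a one-parameter family of metrics $g_{ab}(\gamma)$, let $\nabla_a$ be its metric-compatible torsion-free connection, $C_{abcd}=C_{abcd}(\gamma)$ its Weyl tensor (all indices lowered with $g_{ab}(\gamma)$) and $R_{ab}=R_{ab}(\gamma)$ its Ricci tensor. The first order (linearized) Weyl and Ricci tensors are $$C^{(1)}_{abcd}=\frac{d}{d\gamma}C_{abcd}\Big|_{\gamma=0},\qquad R^{(1)}_{ab}=\frac{d}{d\gamma}R_{ab}\Big|_{\gamma=0}.$$ For reference, the nonlinear Goldberg-Sachs theorem says that a vacuum metric admits a shear-free null geodesic congruence $l^a$ if and only if $l^a$ is a degenerate eigendirection of the Weyl tensor, i.e. $C_{abc[d}l_{e]}l^bl^c=0$. *)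

theory Defs
  imports "HOL-Analysis.Analysis"
begin

text \<open>
  Everything is expressed in the standard coordinates of \<open>\<real>\<^sup>4\<close>, modelled by the type \<^typ>\<open>real^4\<close>.
  The time coordinate is number \<^term>\<open>0::4\<close> (which equals \<^term>\<open>4::4\<close>), the space
  coordinates are 1, 2, 3. A metric is a matrix-valued function of the coordinates.
\<close>

section \<open>Smooth maps on open sets\<close>

primrec C_k_on ::
  "nat \<Rightarrow> 'a::real_normed_vector set \<Rightarrow> ('a \<Rightarrow> 'b::real_normed_vector) \<Rightarrow> bool" where
  "C_k_on 0 S f \<longleftrightarrow> continuous_on S f"
| "C_k_on (Suc k) S f \<longleftrightarrow>
     (\<forall>x\<in>S. f differentiable (at x)) \<and> (\<forall>v. C_k_on k S (\<lambda>x. frechet_derivative f (at x) v))"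

text \<open>Since the derivatives are taken at full neighbourhoods, \<open>S\<close> is meant to be open.\<close>

definition smooth_on ::
  "'a::real_normed_vector set \<Rightarrow> ('a \<Rightarrow> 'b::real_normed_vector) \<Rightarrow> bool" where
  "smooth_on S f \<longleftrightarrow> (\<forall>k. C_k_on k S f)"

definition pd :: "4 \<Rightarrow> (real^4 \<Rightarrow> real) \<Rightarrow> real^4 \<Rightarrow> real" where
  "pd i f x = frechet_derivative f (at x) (axis i 1)"

section \<open>Lorentzian metrics\<close>

definition minkowski :: "real^4^4" where
  "minkowski = (\<chi> a b. if a = b then (if a = 0 then -1 else 1) else 0)"

text \<open>A symmetric bilinear form is Lorentzian if it admits an orthonormal frame (the columns
  of \<open>P\<close>) with signature \<open>(-,+,+,+)\<close>.\<close>

definition lorentzian :: "real^4^4 \<Rightarrow> bool" where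
  "lorentzian A \<longleftrightarrow> transpose A = A \<and>
     (\<exists>P. invertible P \<and> transpose P ** A ** P = minkowski)"

definition inv_metric :: "(real^4 \<Rightarrow> real^4^4) \<Rightarrow> 4 \<Rightarrow> 4 \<Rightarrow> real^4 \<Rightarrow> real" where
  "inv_metric g a b x = matrix_inv (g x) $ a $ b"

definition lower :: "(real^4 \<Rightarrow> real^4^4) \<Rightarrow> (real^4 \<Rightarrow> real^4) \<Rightarrow> real^4 \<Rightarrow> real^4" where
  "lower g l x = (\<chi> a. \<Sum>b\<in>UNIV. g x $ a $ b * l x $ b)"

section \<open>The Levi-Civita connection\<close>

text \<open>\<open>christoffel g a b c\<close> is \<open>\<Gamma>\<^sup>a\<^sub>b\<^sub>c\<close>. The lemma \<open>levi_civita_iff_christoffel\<close> below shows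
  that these are the coefficients of the unique torsion-free metric-compatible connection.\<close>

definition christoffel :: "(real^4 \<Rightarrow> real^4^4) \<Rightarrow> 4 \<Rightarrow> 4 \<Rightarrow> 4 \<Rightarrow> real^4 \<Rightarrow> real" where
  "christoffel g a b c x = (\<Sum>d\<in>UNIV. inv_metric g a d x / 2 *
     (pd b (\<lambda>y. g y $ d $ c) x + pd c (\<lambda>y. g y $ d $ b) x - pd d (\<lambda>y. g y $ b $ c) x))"

definition torsion_free :: "(4 \<Rightarrow> 4 \<Rightarrow> 4 \<Rightarrow> real) \<Rightarrow> bool" where
  "torsion_free \<Gamma> \<longleftrightarrow> (\<forall>a b c. \<Gamma> a b c = \<Gamma> a c b)"

definition metric_compatible_at ::
  "(real^4 \<Rightarrow> real^4^4) \<Rightarrow> real^4 \<Rightarrow> (4 \<Rightarrow> 4 \<Rightarrow> 4 \<Rightarrow> real) \<Rightarrow> bool" where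
  "metric_compatible_at g x \<Gamma> \<longleftrightarrow> (\<forall>a b c. pd c (\<lambda>y. g y $ a $ b) x
     - (\<Sum>d\<in>UNIV. \<Gamma> d c a * g x $ d $ b) - (\<Sum>d\<in>UNIV. \<Gamma> d c b * g x $ a $ d) = 0)"

lemma lorentzian_invertible: "lorentzian A \<Longrightarrow> invertible A"
proof -
  assume "lorentzian A"
  then obtain P where P: "invertible P" "transpose P ** A ** P = minkowski"
    by (auto simp: lorentzian_def)
  have "minkowski ** minkowski = mat 1"
    by (auto simp: minkowski_def matrix_matrix_mult_def mat_def vec_eq_iff sum.delta
        if_distrib[where f="\<lambda>t. t * _"] cong: if_cong)
  then have "(transpose P ** A ** P) ** minkowski = mat 1"
    by (simp add: P)
  then have "det (transpose P ** A ** P) \<noteq> 0"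
    by (metis det_I det_mul mult_zero_left zero_neq_one)
  then show ?thesis
    by (simp add: det_mul invertible_det_nz)
qed

lemma pd_cong_open:
  assumes "open U" "x \<in> U" "\<And>y. y \<in> U \<Longrightarrow> f y = h y"
  shows "pd i f x = pd i h x"
proof -
  have "(f has_derivative F) (at x) \<longleftrightarrow> (h has_derivative F) (at x)" for F
    using has_derivative_transform_within_open[of _ F x UNIV U] assms by metis
  then show ?thesis by (simp add: pd_def frechet_derivative_def)
qed

lemma levi_civita_iff_christoffel:
  assumes U: "open U" "x \<in> U" and lor: "\<And>y. y \<in> U \<Longrightarrow> lorentzian (g y)"
  shows "torsion_free \<Gamma> \<and> metric_compatible_at g x \<Gamma> \<longleftrightarrow> \<Gamma> = (\<lambda>a b c. christoffel g a b c x)"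
proof -
  have sym: "g y $ a $ b = g y $ b $ a" if "y \<in> U" for y a b
  proof -
    have "transpose (g y) $ b $ a = g y $ b $ a"
      using lor[OF that] by (simp add: lorentzian_def)
    then show ?thesis by (simp add: transpose_def)
  qed
  define D where "D c a b = pd c (\<lambda>y. g y $ a $ b) x" for c a b
  have D: "D c a b = D c b a" for a b c
    unfolding D_def by (rule pd_cong_open[OF U]) (rule sym)
  have ch: "christoffel g a b c x
      = (\<Sum>d\<in>UNIV. matrix_inv (g x) $ a $ d * ((D b d c + D c d b - D d b c) / 2))" for a b c
    by (simp add: christoffel_def D_def inv_metric_def)
  define L where "L \<Gamma> e b c = (\<Sum>d\<in>UNIV. g x $ e $ d * \<Gamma> d b c)" for \<Gamma> :: "4\<Rightarrow>4\<Rightarrow>4\<Rightarrow>real" and e b c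
  have inv: "invertible (g x)" using lorentzian_invertible lor U by blast
  have mi: "g x ** matrix_inv (g x) = mat 1 \<and> matrix_inv (g x) ** g x = mat 1"
    using inv unfolding invertible_def matrix_inv_def by (rule someI_ex)
  have delta: "(\<Sum>f\<in>UNIV. (if e = f then 1 else 0) * F f) = F e" for e :: 4 and F :: "4 \<Rightarrow> real"
    by (simp add: if_distrib[where f="\<lambda>t. t * _"] sum.delta cong: if_cong)
  have I1: "(\<Sum>d\<in>UNIV. g x $ a $ d * matrix_inv (g x) $ d $ b) = (if a = b then 1 else 0)" for a b
    using arg_cong[OF conjunct1[OF mi], of "\<lambda>M. M $ a $ b"]
    by (simp add: matrix_matrix_mult_def mat_def)
  have I2: "(\<Sum>d\<in>UNIV. matrix_inv (g x) $ a $ d * g x $ d $ b) = (if a = b then 1 else 0)" for a b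
    using arg_cong[OF conjunct2[OF mi], of "\<lambda>M. M $ a $ b"]
    by (simp add: matrix_matrix_mult_def mat_def)
  have Lch: "L (\<lambda>a b c. christoffel g a b c x) e b c = (D b e c + D c e b - D e b c) / 2" for e b c
  proof -
    have "L (\<lambda>a b c. christoffel g a b c x) e b c = (\<Sum>d\<in>UNIV. \<Sum>f\<in>UNIV.
        g x $ e $ d * matrix_inv (g x) $ d $ f * ((D b f c + D c f b - D f b c) / 2))"
      unfolding L_def ch by (simp only: sum_distrib_left mult.assoc)
    also have "\<dots> = (\<Sum>f\<in>UNIV. (\<Sum>d\<in>UNIV. g x $ e $ d * matrix_inv (g x) $ d $ f)
        * ((D b f c + D c f b - D f b c) / 2))"
      by (subst sum.swap) (simp only: sum_distrib_right)
    also have "\<dots> = (D b e c + D c e b - D e b c) / 2"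
      unfolding I1 by (rule delta)
    finally show ?thesis .
  qed
  have raise: "\<Gamma> a b c = (\<Sum>e\<in>UNIV. matrix_inv (g x) $ a $ e * L \<Gamma> e b c)" for \<Gamma> a b c
  proof -
    have "(\<Sum>e\<in>UNIV. matrix_inv (g x) $ a $ e * L \<Gamma> e b c)
        = (\<Sum>e\<in>UNIV. \<Sum>d\<in>UNIV. matrix_inv (g x) $ a $ e * g x $ e $ d * \<Gamma> d b c)"
      unfolding L_def by (simp only: sum_distrib_left mult.assoc)
    also have "\<dots> = (\<Sum>d\<in>UNIV. (\<Sum>e\<in>UNIV. matrix_inv (g x) $ a $ e * g x $ e $ d) * \<Gamma> d b c)"
      by (subst sum.swap) (simp only: sum_distrib_right)
    also have "\<dots> = \<Gamma> a b c"
      unfolding I2 by (rule delta)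
    finally show ?thesis by simp
  qed
  have mc: "metric_compatible_at g x \<Gamma> \<longleftrightarrow> (\<forall>a b c. D c a b = L \<Gamma> b c a + L \<Gamma> a c b)" for \<Gamma>
  proof -
    have "(\<Sum>d\<in>UNIV. \<Gamma> d c a * g x $ d $ b) = L \<Gamma> b c a" for a b c
      unfolding L_def using sym[OF U(2)] by (metis mult.commute)
    moreover have "(\<Sum>d\<in>UNIV. \<Gamma> d c b * g x $ a $ d) = L \<Gamma> a c b" for a b c
      unfolding L_def by (metis mult.commute)
    ultimately show ?thesis
      unfolding metric_compatible_at_def D_def by (simp add: algebra_simps)
  qed
  show ?thesis
  proof
    assume *: "torsion_free \<Gamma> \<and> metric_compatible_at g x \<Gamma>"
    then have s: "L \<Gamma> e b c = L \<Gamma> e c b" for e b c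
      unfolding torsion_free_def L_def by metis
    have m: "D c a b = L \<Gamma> b c a + L \<Gamma> a c b" for a b c
      using * mc by blast
    have eq: "L \<Gamma> e b c = L (\<lambda>a b c. christoffel g a b c x) e b c" for e b c
      unfolding Lch m using s[of e b c] s[of b c e] s[of c b e] by simp
    have "\<Gamma> a b c = christoffel g a b c x" for a b c
      using raise[of \<Gamma> a b c] raise[of "\<lambda>a b c. christoffel g a b c x" a b c]
      unfolding eq by metis
    then show "\<Gamma> = (\<lambda>a b c. christoffel g a b c x)"
      by (intro ext)
  next
    assume *: "\<Gamma> = (\<lambda>a b c. christoffel g a b c x)"
    have "torsion_free \<Gamma>"
      unfolding torsion_free_def * ch using D by (simp add: add.commute)
    moreover have "metric_compatible_at g x \<Gamma>"
      unfolding mc * Lch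
    proof (intro allI)
      fix a b c
      show "D c a b = (D c b a + D a b c - D b c a) / 2 + (D c a b + D b a c - D a c b) / 2"
        using D[of c b a] D[of b c a] D[of a b c] by (simp add: field_simps)
    qed
    ultimately show "torsion_free \<Gamma> \<and> metric_compatible_at g x \<Gamma>" by simp
  qed
qed

text \<open>\<open>nabla_vec g l a b\<close> is \<open>\<nabla>\<^sub>a l\<^sup>b\<close> and \<open>nabla_covec g w a b\<close> is \<open>\<nabla>\<^sub>a w\<^sub>b\<close>.\<close>

definition nabla_vec ::
  "(real^4 \<Rightarrow> real^4^4) \<Rightarrow> (real^4 \<Rightarrow> real^4) \<Rightarrow> 4 \<Rightarrow> 4 \<Rightarrow> real^4 \<Rightarrow> real" where
  "nabla_vec g l a b x =
     pd a (\<lambda>y. l y $ b) x + (\<Sum>c\<in>UNIV. christoffel g b a c x * l x $ c)"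

definition nabla_covec ::
  "(real^4 \<Rightarrow> real^4^4) \<Rightarrow> (real^4 \<Rightarrow> real^4) \<Rightarrow> 4 \<Rightarrow> 4 \<Rightarrow> real^4 \<Rightarrow> real" where
  "nabla_covec g w a b x =
     pd a (\<lambda>y. w y $ b) x - (\<Sum>c\<in>UNIV. christoffel g c a b x * w x $ c)"

definition sym_part :: "(4 \<Rightarrow> 4 \<Rightarrow> real) \<Rightarrow> 4 \<Rightarrow> 4 \<Rightarrow> real" where
  "sym_part T a b = (T a b + T b a) / 2"

definition antisym_part :: "(4 \<Rightarrow> 4 \<Rightarrow> real) \<Rightarrow> 4 \<Rightarrow> 4 \<Rightarrow> real" where
  "antisym_part T a b = (T a b - T b a) / 2"

section \<open>Curvature\<close>

text \<open>\<open>riemann_up g a b c d\<close> is \<open>R\<^sup>a\<^sub>b\<^sub>c\<^sub>d\<close>, with the convention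
  \<open>R\<^sup>a\<^sub>b\<^sub>c\<^sub>d v\<^sup>b = (\<nabla>\<^sub>c \<nabla>\<^sub>d - \<nabla>\<^sub>d \<nabla>\<^sub>c) v\<^sup>a\<close> and \<open>R\<^sub>b\<^sub>d = R\<^sup>a\<^sub>b\<^sub>a\<^sub>d\<close>.\<close>

definition riemann_up :: "(real^4 \<Rightarrow> real^4^4) \<Rightarrow> 4 \<Rightarrow> 4 \<Rightarrow> 4 \<Rightarrow> 4 \<Rightarrow> real^4 \<Rightarrow> real" where
  "riemann_up g a b c d x =
     pd c (christoffel g a d b) x - pd d (christoffel g a c b) x
     + (\<Sum>e\<in>UNIV. christoffel g a c e x * christoffel g e d b x
                - christoffel g a d e x * christoffel g e c b x)"

definition riemann :: "(real^4 \<Rightarrow> real^4^4) \<Rightarrow> 4 \<Rightarrow> 4 \<Rightarrow> 4 \<Rightarrow> 4 \<Rightarrow> real^4 \<Rightarrow> real" where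
  "riemann g a b c d x = (\<Sum>e\<in>UNIV. g x $ a $ e * riemann_up g e b c d x)"

definition ricci :: "(real^4 \<Rightarrow> real^4^4) \<Rightarrow> 4 \<Rightarrow> 4 \<Rightarrow> real^4 \<Rightarrow> real" where
  "ricci g b d x = (\<Sum>a\<in>UNIV. riemann_up g a b a d x)"

definition scalar_curv :: "(real^4 \<Rightarrow> real^4^4) \<Rightarrow> real^4 \<Rightarrow> real" where
  "scalar_curv g x = (\<Sum>a\<in>UNIV. \<Sum>b\<in>UNIV. inv_metric g a b x * ricci g a b x)"

text \<open>The Weyl tensor in dimension 4, that is, the trace-free part of the Riemann tensor:
  \<open>C\<^sub>a\<^sub>b\<^sub>c\<^sub>d = R\<^sub>a\<^sub>b\<^sub>c\<^sub>d - (g\<^sub>a\<^sub>[\<^sub>c R\<^sub>d\<^sub>]\<^sub>b - g\<^sub>b\<^sub>[\<^sub>c R\<^sub>d\<^sub>]\<^sub>a) + (1/3) R g\<^sub>a\<^sub>[\<^sub>c g\<^sub>d\<^sub>]\<^sub>b\<close>.\<close>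

definition weyl :: "(real^4 \<Rightarrow> real^4^4) \<Rightarrow> 4 \<Rightarrow> 4 \<Rightarrow> 4 \<Rightarrow> 4 \<Rightarrow> real^4 \<Rightarrow> real" where
  "weyl g a b c d x = riemann g a b c d x
     - (antisym_part (\<lambda>c d. g x $ a $ c * ricci g d b x) c d
        - antisym_part (\<lambda>c d. g x $ b $ c * ricci g d a x) c d)
     + scalar_curv g x / 3 * antisym_part (\<lambda>c d. g x $ a $ c * g x $ d $ b) c d"

section \<open>First order quantities of a one-parameter family of metrics\<close>

definition ricci1 :: "(real \<Rightarrow> real^4 \<Rightarrow> real^4^4) \<Rightarrow> 4 \<Rightarrow> 4 \<Rightarrow> real^4 \<Rightarrow> real" where
  "ricci1 g a b x = deriv (\<lambda>\<gamma>. ricci (g \<gamma>) a b x) 0"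

definition weyl1 :: "(real \<Rightarrow> real^4 \<Rightarrow> real^4^4) \<Rightarrow> 4 \<Rightarrow> 4 \<Rightarrow> 4 \<Rightarrow> 4 \<Rightarrow> real^4 \<Rightarrow> real" where
  "weyl1 g a b c d x = deriv (\<lambda>\<gamma>. weyl (g \<gamma>) a b c d x) 0"

section \<open>Shear-free null geodesic congruences and degenerate eigendirections\<close>

definition null_on :: "(real^4) set \<Rightarrow> (real^4 \<Rightarrow> real^4^4) \<Rightarrow> (real^4 \<Rightarrow> real^4) \<Rightarrow> bool" where
  "null_on U g l \<longleftrightarrow>
     (\<forall>x\<in>U. (\<Sum>a\<in>UNIV. \<Sum>b\<in>UNIV. l x $ a * l x $ b * g x $ a $ b) = 0)"

definition geodesic_on :: "(real^4) set \<Rightarrow> (real^4 \<Rightarrow> real^4^4) \<Rightarrow> (real^4 \<Rightarrow> real^4) \<Rightarrow> bool" where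
  "geodesic_on U g l \<longleftrightarrow> (\<exists>\<phi> :: real^4 \<Rightarrow> real. smooth_on U \<phi> \<and>
     (\<forall>x\<in>U. \<forall>b. (\<Sum>a\<in>UNIV. l x $ a * nabla_vec g l a b x) = \<phi> x * l x $ b))"

definition shear_free_on :: "(real^4) set \<Rightarrow> (real^4 \<Rightarrow> real^4^4) \<Rightarrow> (real^4 \<Rightarrow> real^4) \<Rightarrow> bool" where
  "shear_free_on U g l \<longleftrightarrow>
     (\<exists>(J :: real^4 \<Rightarrow> real^4) (\<theta> :: real^4 \<Rightarrow> real). smooth_on U J \<and> smooth_on U \<theta> \<and>
       (\<forall>x\<in>U. \<forall>a b. sym_part (\<lambda>a b. nabla_covec g (lower g l) a b x) a b
          = sym_part (\<lambda>a b. J x $ a * lower g l x $ b) a b + \<theta> x * g x $ a $ b))"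

text \<open>\<open>C1_degeneracy g l a d e\<close> is \<open>C\<^sup>(\<^sup>1\<^sup>)\<^sub>a\<^sub>b\<^sub>c\<^sub>[\<^sub>d l\<^sub>e\<^sub>] l\<^sup>b l\<^sup>c\<close>, the index of \<open>l\<close> being lowered with
  the Minkowski metric.\<close>

definition C1_degeneracy ::
  "(real \<Rightarrow> real^4 \<Rightarrow> real^4^4) \<Rightarrow> (real^4 \<Rightarrow> real^4) \<Rightarrow> 4 \<Rightarrow> 4 \<Rightarrow> 4 \<Rightarrow> real^4 \<Rightarrow> real" where
  "C1_degeneracy g l a d e x = (\<Sum>b\<in>UNIV. \<Sum>c\<in>UNIV.
     antisym_part (\<lambda>d e. weyl1 g a b c d x * lower (\<lambda>_. minkowski) l x $ e) d e
       * l x $ b * l x $ c)"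

end

(*
  Write u = z - t and w = z + t, so that eta = du dw + dx^2 + dy^2, and take l = d_t + d_z = 2 d_w and
    g(gamma) = eta + gamma (4 w x (dx^2 + dy^2) + 2 w^2 du dx).
  For every gamma the covector g(gamma)(l, .) is du, so l is null and geodesic; l is shear-free because
  the w-dependence of g(gamma) sits in a conformal factor of dx^2 + dy^2 and in multiples of du. The
  perturbation is a quadratic polynomial that solves the linearized vacuum equation, and its constant
  Weyl tensor has Psi_1 (the component C_abcd l^a n^b l^c m^d) nonzero. In the nonlinear theorem Psi_1
  is excluded by a relation quadratic in the curvature, which is void at first order.
*)

theory Submission imports Defs begin

section \<open>Rational functions are smooth\<close>

text \<open>Smoothness is obtained from a class of functions closed under directional derivatives,
  so that a structural membership check yields all orders at once.\<close>

inductive rational_on :: "'a::real_normed_vector set \<Rightarrow> ('a \<Rightarrow> real) \<Rightarrow> bool" for S where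
  const: "rational_on S (\<lambda>x. c)"
| linear: "bounded_linear f \<Longrightarrow> rational_on S f"
| add: "rational_on S f \<Longrightarrow> rational_on S g \<Longrightarrow> rational_on S (\<lambda>x. f x + g x)"
| mult: "rational_on S f \<Longrightarrow> rational_on S g \<Longrightarrow> rational_on S (\<lambda>x. f x * g x)"
| inverse: "rational_on S f \<Longrightarrow> \<forall>x\<in>S. f x \<noteq> 0 \<Longrightarrow> rational_on S (\<lambda>x. inverse (f x))"

lemma rational_on_uminus: "rational_on S f \<Longrightarrow> rational_on S (\<lambda>x. - f x)"
  using rational_on.mult[OF rational_on.const[of S "-1"]] by simp

lemma rational_on_diff:
  "rational_on S f \<Longrightarrow> rational_on S g \<Longrightarrow> rational_on S (\<lambda>x. f x - g x)"
  using rational_on.add[OF _ rational_on_uminus] by simp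

lemma rational_on_power: "rational_on S f \<Longrightarrow> rational_on S (\<lambda>x. f x ^ n)"
  by (induction n) (simp_all add: rational_on.const rational_on.mult)

lemma rational_on_divide:
  "rational_on S f \<Longrightarrow> rational_on S g \<Longrightarrow> \<forall>x\<in>S. g x \<noteq> 0 \<Longrightarrow> rational_on S (\<lambda>x. f x / g x)"
  unfolding divide_inverse by (intro rational_on.mult rational_on.inverse)

text \<open>The sum, product and reciprocal rules stay inside the class. One \<open>D\<close> serves
  all directions because \<open>C_k_on\<close> differentiates in an arbitrary direction at every
  level.\<close>

lemma rational_on_has_derivative:
  assumes "rational_on S f"
  shows "\<exists>D. (\<forall>x\<in>S. (f has_derivative D x) (at x)) \<and> (\<forall>v. rational_on S (\<lambda>x. D x v))"
  using assms
proof induction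
  case (const c)
  show ?case
    by (rule exI[of _ "\<lambda>x v. 0"]) (auto intro: rational_on.const)
next
  case (linear f)
  show ?case
    by (rule exI[of _ "\<lambda>x. f"])
      (auto intro: rational_on.const bounded_linear_imp_has_derivative linear)
next
  case (add f g)
  then obtain Df Dg where
    "\<forall>x\<in>S. (f has_derivative Df x) (at x)" "\<forall>v. rational_on S (\<lambda>x. Df x v)"
    "\<forall>x\<in>S. (g has_derivative Dg x) (at x)" "\<forall>v. rational_on S (\<lambda>x. Dg x v)" by blast
  then show ?case
    by (intro exI[of _ "\<lambda>x v. Df x v + Dg x v"])
      (auto intro: rational_on.add has_derivative_add)
next
  case (mult f g)
  then obtain Df Dg where
    "\<forall>x\<in>S. (f has_derivative Df x) (at x)" "\<forall>v. rational_on S (\<lambda>x. Df x v)"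
    "\<forall>x\<in>S. (g has_derivative Dg x) (at x)" "\<forall>v. rational_on S (\<lambda>x. Dg x v)" by blast
  moreover from this mult.hyps have "rational_on S (\<lambda>x. f x * Dg x v + Df x v * g x)" for v
    by (simp add: rational_on.add rational_on.mult)
  ultimately show ?case
    by (intro exI[of _ "\<lambda>x v. f x * Dg x v + Df x v * g x"]) (simp add: has_derivative_mult)
next
  case (inverse f)
  then obtain Df where
    "\<forall>x\<in>S. (f has_derivative Df x) (at x)" "\<forall>v. rational_on S (\<lambda>x. Df x v)" by blast
  moreover from this inverse.hyps
  have "rational_on S (\<lambda>x. - (inverse (f x) * Df x v * inverse (f x)))" for v
    by (simp add: rational_on_uminus rational_on.mult rational_on.inverse)
  ultimately show ?case
    using inverse.hyps by (intro exI[of _ "\<lambda>x v. - (inverse (f x) * Df x v * inverse (f x))"])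
      (simp add: has_derivative_inverse)
qed

text \<open>Differentiation is local, so on an open set \<open>frechet_derivative\<close> may be
  replaced by a formula that is valid on \<open>S\<close> only.\<close>

lemma C_k_on_cong:
  assumes "open S" "\<And>x. x \<in> S \<Longrightarrow> f x = g x" "C_k_on k S f"
  shows "C_k_on k S g"
  using assms(2,3)
proof (induction k arbitrary: f g)
  case 0
  then show ?case using continuous_on_cong by force
next
  case (Suc k)
  have D: "(f has_derivative F) (at x) \<longleftrightarrow> (g has_derivative F) (at x)" if "x \<in> S" for x F
    using has_derivative_transform_within_open[of _ F x UNIV S] \<open>open S\<close> Suc.prems(1) that by metis
  have "frechet_derivative f (at x) = frechet_derivative g (at x)" if "x \<in> S" for x
    using D[OF that] by (simp add: frechet_derivative_def)
  then have "C_k_on k S (\<lambda>x. frechet_derivative g (at x) v)" for v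
    using Suc.IH[of "\<lambda>x. frechet_derivative f (at x) v" "\<lambda>x. frechet_derivative g (at x) v"]
      Suc.prems(2) by simp
  moreover have "\<forall>x\<in>S. g differentiable at x"
    using Suc.prems(2) D by (auto simp: differentiable_def)
  ultimately show ?case by simp
qed

lemma smooth_on_rational:
  fixes f :: "'a::real_normed_vector \<Rightarrow> 'b::euclidean_space"
  assumes "open S" and "\<And>b. b \<in> Basis \<Longrightarrow> rational_on S (\<lambda>x. f x \<bullet> b)"
  shows "smooth_on S f"
proof -
  have "C_k_on k S f" if "\<And>b. b \<in> Basis \<Longrightarrow> rational_on S (\<lambda>x. f x \<bullet> b)"
    for k and f :: "'a \<Rightarrow> 'b"
    using that
  proof (induction k arbitrary: f)
    case 0
    have "f differentiable at x within S" if "x \<in> S" for x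
    proof -
      have "\<exists>D. ((\<lambda>x. f x \<bullet> b) has_derivative D) (at x within S)" if "b \<in> Basis" for b
        using rational_on_has_derivative[OF 0[OF that]] \<open>x \<in> S\<close> has_derivative_at_withinI by blast
      then show ?thesis
        by (subst differentiable_componentwise_within) (auto simp: differentiable_def)
    qed
    then show ?case
      by (simp add: differentiable_imp_continuous_on differentiable_on_def)
  next
    case (Suc k)
    have "\<forall>b\<in>Basis. \<exists>D. (\<forall>x\<in>S. ((\<lambda>x. f x \<bullet> b) has_derivative D x) (at x))
        \<and> (\<forall>v. rational_on S (\<lambda>x. D x v))"
      using rational_on_has_derivative Suc.prems by blast
    then obtain D where D: "\<And>b x. b \<in> Basis \<Longrightarrow> x \<in> S \<Longrightarrow> ((\<lambda>x. f x \<bullet> b) has_derivative D b x) (at x)"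
      "\<And>b v. b \<in> Basis \<Longrightarrow> rational_on S (\<lambda>x. D b x v)"
      by metis
    \<comment> \<open>The componentwise derivatives are reassembled into one for the vector-valued
      \<open>f\<close>; its components are rational again, so the induction hypothesis
      applies.\<close>
    define F where "F x v = (\<Sum>b\<in>Basis. D b x v *\<^sub>R b)" for x v
    have F: "F x v \<bullet> b = D b x v" if "b \<in> Basis" for x v b
      using that by (simp add: F_def)
    have "(f has_derivative F x) (at x)" if "x \<in> S" for x
      by (subst has_derivative_componentwise_within) (simp add: F D that)
    then have "f differentiable at x \<and> frechet_derivative f (at x) = F x" if "x \<in> S" for x
      using that frechet_derivative_at by (metis differentiable_def)
    moreover have "C_k_on k S (\<lambda>x. F x v)" for v
      by (rule Suc.IH) (simp add: F D)
    ultimately show ?case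
      by (auto intro: C_k_on_cong[OF \<open>open S\<close>, of "\<lambda>x. F x _"])
  qed
  then show ?thesis
    using assms(2) by (simp add: smooth_on_def)
qed

section \<open>Derivatives\<close>

lemma pd_eqI: "(f has_derivative F) (at x) \<Longrightarrow> pd i f x = F (axis i 1)"
  unfolding pd_def by (simp flip: frechet_derivative_at)

text \<open>The difference quotient at 0 is \<open>Q\<close> itself, so continuity is enough. It
  serves for curvature that has a factor of the family parameter.\<close>

lemma has_real_derivative_scaled_at_0:
  fixes Q :: "real \<Rightarrow> real"
  assumes "isCont Q 0"
  shows "((\<lambda>t. t * Q t) has_real_derivative Q 0) (at 0)"
proof -
  have "((\<lambda>t. t * Q t / t) \<longlongrightarrow> Q 0) (at 0)"
    by (rule Lim_transform_eventually[OF assms[unfolded isCont_def]])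
      (auto simp: eventually_at intro: exI[of _ 1])
  then show ?thesis
    by (simp add: has_field_derivative_iff)
qed

text \<open>Since \<open>r\<close> vanishes at \<open>a\<close>, the difference quotient of the
  product is \<open>F\<close> times that of \<open>r\<close>.\<close>

lemma has_real_derivative_mult_zero:
  fixes F r :: "real \<Rightarrow> real"
  assumes "isCont F a" "(r has_real_derivative r') (at a)" "r a = 0"
  shows "((\<lambda>t. F t * r t) has_real_derivative F a * r') (at a)"
proof -
  have "((\<lambda>t. F t * ((r t - r a) / (t - a))) \<longlongrightarrow> F a * r') (at a)"
    using assms(1,2) unfolding isCont_def has_field_derivative_iff by (rule tendsto_mult)
  then show ?thesis
    using assms(3) by (simp add: has_field_derivative_iff)
qed

section \<open>Constant vector fields\<close>

text \<open>Numerals of type \<open>4\<close> are taken modulo 4: \<open>sum_4\<close> and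
  \<open>forall_4\<close> end at index 4, while the definitions test for 0.\<close>

lemma four_eq_zero: "(4::4) = 0"
  by simp

lemma sum_4_from_0: "(\<Sum>a\<in>UNIV. f a) = f 0 + f 1 + f 2 + f (3::4)"
  unfolding sum_4 four_eq_zero by (simp only: ac_simps)

lemma forall_4_from_0: "(\<forall>a. P a) \<longleftrightarrow> P 0 \<and> P 1 \<and> P 2 \<and> P (3::4)"
  unfolding forall_4 four_eq_zero by auto

text \<open>\<open>matrix_inv\<close> is a choice; for square matrices a right inverse is two-sided
  and hence the only candidate.\<close>

lemma matrix_inv_eqI:
  fixes A B :: "real^'n^'n"
  assumes "A ** B = mat 1"
  shows "matrix_inv A = B"
proof -
  have "A ** matrix_inv A = mat 1 \<and> matrix_inv A ** A = mat 1"
    unfolding matrix_inv_def by (rule someI[of _ B]) (use assms matrix_left_right_inverse in blast)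
  then show ?thesis
    by (metis assms matrix_mul_assoc matrix_mul_lid matrix_mul_rid)
qed

lemma pd_sum_mult:
  fixes k :: "4 \<Rightarrow> real"
  assumes "\<And>d. f d differentiable (at x)"
  shows "pd a (\<lambda>y. \<Sum>d\<in>UNIV. f d y * k d) x = (\<Sum>d\<in>UNIV. pd a (f d) x * k d)"
proof -
  have "((\<lambda>y. \<Sum>d\<in>UNIV. f d y * k d) has_derivative
      (\<lambda>v. \<Sum>d\<in>UNIV. frechet_derivative (f d) (at x) v * k d)) (at x)"
    using assms frechet_derivative_works
    by (intro has_derivative_sum has_derivative_mult_left) blast
  from pd_eqI[OF this] show ?thesis by (simp add: pd_def)
qed

text \<open>Contraction with the metric cancels its inverse and leaves the Christoffel symbols of
  the first kind.\<close>

lemma lower_christoffel: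
  assumes "invertible (g x)"
  shows "(\<Sum>e\<in>UNIV. g x $ a $ e * christoffel g e b c x)
    = (pd b (\<lambda>y. g y $ a $ c) x + pd c (\<lambda>y. g y $ a $ b) x - pd a (\<lambda>y. g y $ b $ c) x) / 2"
proof -
  define s where "s d = (pd b (\<lambda>y. g y $ d $ c) x + pd c (\<lambda>y. g y $ d $ b) x - pd d (\<lambda>y. g y $ b $ c) x) / 2" for d
  have "g x ** matrix_inv (g x) = mat 1"
    using assms matrix_inv_eqI unfolding invertible_def by metis
  moreover have "christoffel g e b c x = (matrix_inv (g x) *v (\<chi> d. s d)) $ e" for e
    by (simp add: christoffel_def s_def inv_metric_def matrix_vector_mult_def)
  then have "(\<Sum>e\<in>UNIV. g x $ a $ e * christoffel g e b c x)
      = (g x *v (matrix_inv (g x) *v (\<chi> d. s d))) $ a"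
    by (simp add: matrix_vector_mult_def)
  ultimately show ?thesis
    by (simp add: matrix_vector_mul_assoc s_def)
qed

text \<open>The right-hand side is half the Lie derivative of the metric along \<open>k\<close>.\<close>

lemma sym_nabla_lower_const:
  assumes "open U" "x \<in> U" "invertible (g x)"
    and sym: "\<And>y a b. y \<in> U \<Longrightarrow> g y $ a $ b = g y $ b $ a"
    and diff: "\<And>a b. (\<lambda>y. g y $ a $ b) differentiable (at x)"
  shows "sym_part (\<lambda>a b. nabla_covec g (lower g (\<lambda>_. k)) a b x) a b
    = (\<Sum>c\<in>UNIV. k $ c * pd c (\<lambda>y. g y $ a $ b) x) / 2"
proof -
  define D where "D c a b = pd c (\<lambda>y. g y $ a $ b) x" for c a b
  have D: "D c a b = D c b a" for a b c
    unfolding D_def by (rule pd_cong_open[OF assms(1,2)]) (rule sym)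
  have "nabla_covec g (lower g (\<lambda>_. k)) a b x
      = (\<Sum>d\<in>UNIV. k $ d * (D a b d - (D a d b + D b d a - D d a b) / 2))" for a b
  proof -
    have "(\<Sum>c\<in>UNIV. christoffel g c a b x * lower g (\<lambda>_. k) x $ c)
        = (\<Sum>d\<in>UNIV. k $ d * (\<Sum>c\<in>UNIV. g x $ d $ c * christoffel g c a b x))"
      by (simp add: lower_def sum_4_from_0 algebra_simps sym[OF assms(2), of 1 0]
        sym[OF assms(2), of 2 0] sym[OF assms(2), of 3 0] sym[OF assms(2), of 2 1]
        sym[OF assms(2), of 3 1] sym[OF assms(2), of 3 2])
    then show ?thesis
      by (simp add: nabla_covec_def lower_def pd_sum_mult[OF diff] lower_christoffel[of g x, OF assms(3)]
        flip: D_def) (simp add: sum_subtractf[symmetric] algebra_simps)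
  qed
  \<comment> \<open>\<open>D a b d\<close> and \<open>D b d a\<close> enter with opposite signs, so
    symmetrization leaves only \<open>D d a b\<close>.\<close>
  then have "sym_part (\<lambda>a b. nabla_covec g (lower g (\<lambda>_. k)) a b x) a b
      = (\<Sum>d\<in>UNIV. k $ d * D d a b) / 2"
    unfolding sym_part_def
    by (simp add: sum.distrib[symmetric] D[of _ b a] D[of a _ b] D[of b _ a] field_simps)
  then show ?thesis by (simp add: D_def)
qed

text \<open>In the Christoffel symbols contracted twice with \<open>k\<close>, every term contains a
  derivative of the lowered \<open>k\<close>, which is the constant \<open>m\<close>. The
  acceleration is therefore zero.\<close>

lemma geodesic_on_const:
  assumes "open U"
    and sym: "\<And>y a b. y \<in> U \<Longrightarrow> g y $ a $ b = g y $ b $ a"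
    and diff: "\<And>x a b. x \<in> U \<Longrightarrow> (\<lambda>y. g y $ a $ b) differentiable (at x)"
    and const: "\<And>y. y \<in> U \<Longrightarrow> lower g (\<lambda>_. k) y = m"
  shows "geodesic_on U g (\<lambda>_. k)"
proof -
  have "(\<Sum>a\<in>UNIV. k $ a * nabla_vec g (\<lambda>_. k) a b x) = 0" if x: "x \<in> U" for x b
  proof -
    define D where "D c a b = pd c (\<lambda>y. g y $ a $ b) x" for c a b
    have D: "(\<Sum>c\<in>UNIV. D a d c * k $ c) = 0" for a d
    proof -
      have "(\<Sum>c\<in>UNIV. D a d c * k $ c) = pd a (\<lambda>y. lower g (\<lambda>_. k) y $ d) x"
        by (simp add: D_def lower_def pd_sum_mult[OF diff[OF x]])
      also have "\<dots> = pd a (\<lambda>y. m $ d) x"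
        by (rule pd_cong_open[OF \<open>open U\<close> x]) (simp add: const)
      also have "\<dots> = 0" by (simp add: pd_def)
      finally show ?thesis .
    qed
    have "(\<Sum>a\<in>UNIV. k $ a * nabla_vec g (\<lambda>_. k) a b x)
        = (\<Sum>a\<in>UNIV. \<Sum>c\<in>UNIV. \<Sum>d\<in>UNIV. inv_metric g b d x / 2 *
            (k $ a * (D a d c * k $ c) + k $ c * (D c d a * k $ a) - k $ a * (D d a c * k $ c)))"
      by (simp add: nabla_vec_def christoffel_def pd_def[of _ "\<lambda>y. k $ b"] sum_distrib_left
        sum_distrib_right D_def algebra_simps)
    \<comment> \<open>Moving the sum over \<open>d\<close> outermost exposes in every term a
      contraction that vanishes by \<open>D\<close>.\<close>
    also have "\<dots> = (\<Sum>a\<in>UNIV. \<Sum>d\<in>UNIV. \<Sum>c\<in>UNIV. inv_metric g b d x / 2 *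
            (k $ a * (D a d c * k $ c) + k $ c * (D c d a * k $ a) - k $ a * (D d a c * k $ c)))"
      by (intro sum.cong refl sum.swap)
    also have "\<dots> = (\<Sum>d\<in>UNIV. \<Sum>a\<in>UNIV. \<Sum>c\<in>UNIV. inv_metric g b d x / 2 *
            (k $ a * (D a d c * k $ c) + k $ c * (D c d a * k $ a) - k $ a * (D d a c * k $ c)))"
      by (rule sum.swap)
    also have "\<dots> = (\<Sum>d\<in>UNIV. inv_metric g b d x / 2 *
         ((\<Sum>a\<in>UNIV. k $ a * (\<Sum>c\<in>UNIV. D a d c * k $ c))
          + (\<Sum>c\<in>UNIV. k $ c * (\<Sum>a\<in>UNIV. D c d a * k $ a))
          - (\<Sum>a\<in>UNIV. k $ a * (\<Sum>c\<in>UNIV. D d a c * k $ c))))"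
      by (rule sum.cong[OF refl]) (simp add: sum_4_from_0 algebra_simps)
    finally show ?thesis by (simp add: D)
  qed
  then show ?thesis
    unfolding geodesic_on_def
    by (intro exI[of _ "\<lambda>_. 0"]) (auto intro!: smooth_on_rational rational_on.const \<open>open U\<close>)
qed

section \<open>Linearization at a flat metric\<close>

text \<open>The derivative terms scale with \<gamma> and the quadratic ones with its square; one
  factor \<gamma> is pulled out to prepare for differentiation at 0.\<close>

lemma riemann_up_scaled_connection:
  assumes "open U" "x \<in> U"
    and chr: "\<And>y a b c. y \<in> U \<Longrightarrow> christoffel g a b c y = \<gamma> * G a b c y"
    and der: "\<And>a b c. (G a b c has_derivative dG a b c) (at x)"
  shows "riemann_up g a b c d x = \<gamma> * (dG a d b (axis c 1) - dG a c b (axis d 1)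
    + \<gamma> * (\<Sum>e\<in>UNIV. G a c e x * G e d b x - G a d e x * G e c b x))"
proof -
  have "pd i (christoffel g a b c) x = \<gamma> * dG a b c (axis i 1)" for i a b c
  proof -
    have "pd i (christoffel g a b c) x = pd i (\<lambda>y. \<gamma> * G a b c y) x"
      by (rule pd_cong_open[OF assms(1,2) chr])
    also have "\<dots> = \<gamma> * dG a b c (axis i 1)"
      by (rule pd_eqI[OF has_derivative_mult_right[OF der]])
    finally show ?thesis .
  qed
  then show ?thesis
    by (simp add: riemann_up_def chr[OF \<open>x \<in> U\<close>] sum_distrib_left algebra_simps)
qed

text \<open>The part quadratic in the connection keeps a further factor \<gamma> and drops out at
  0.\<close>

lemma has_real_derivative_riemann_up:
  assumes "open U" "x \<in> U" "open I" "0 \<in> I"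
    and chr: "\<And>\<gamma> y a b c. \<gamma> \<in> I \<Longrightarrow> y \<in> U \<Longrightarrow> christoffel (g \<gamma>) a b c y = \<gamma> * G \<gamma> a b c y"
    and der: "\<And>\<gamma> a b c. \<gamma> \<in> I \<Longrightarrow> (G \<gamma> a b c has_derivative dG \<gamma> a b c) (at x)"
    and cont: "\<And>a b c. isCont (\<lambda>\<gamma>. G \<gamma> a b c x) 0" "\<And>a b c v. isCont (\<lambda>\<gamma>. dG \<gamma> a b c v) 0"
  shows "((\<lambda>\<gamma>. riemann_up (g \<gamma>) a b c d x) has_real_derivative
      dG 0 a d b (axis c 1) - dG 0 a c b (axis d 1)) (at 0)"
proof -
  define Q where "Q \<gamma> = dG \<gamma> a d b (axis c 1) - dG \<gamma> a c b (axis d 1)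
    + \<gamma> * (\<Sum>e\<in>UNIV. G \<gamma> a c e x * G \<gamma> e d b x - G \<gamma> a d e x * G \<gamma> e c b x)" for \<gamma>
  have "isCont Q 0"
    unfolding Q_def by (intro continuous_intros cont)
  from has_real_derivative_scaled_at_0[OF this]
  have "((\<lambda>\<gamma>. riemann_up (g \<gamma>) a b c d x) has_real_derivative Q 0) (at 0)"
    by (rule has_field_derivative_transform_within_open[OF _ \<open>open I\<close> \<open>0 \<in> I\<close>])
      (simp add: Q_def riemann_up_scaled_connection[OF assms(1,2) chr der])
  then show ?thesis by (simp add: Q_def)
qed

text \<open>The Ricci tensor and its first variation both vanish at 0, and every trace term of the
  Weyl tensor has such a factor. Only the Riemann term survives, with its index lowered by the
  background metric.\<close>

lemma weyl1_linearized_vacuum: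
  assumes R: "\<And>a b c d. ((\<lambda>\<gamma>. riemann_up (g \<gamma>) a b c d x) has_real_derivative R a b c d) (at 0)"
    and flat: "\<And>a b c d. riemann_up (g 0) a b c d x = 0"
    and vac: "\<And>b d. (\<Sum>a\<in>UNIV. R a b a d) = 0"
    and cont: "\<And>a b. isCont (\<lambda>\<gamma>. g \<gamma> x $ a $ b) 0" "\<And>a b. isCont (\<lambda>\<gamma>. inv_metric (g \<gamma>) a b x) 0"
  shows "weyl1 g a b c d x = (\<Sum>e\<in>UNIV. g 0 x $ a $ e * R e b c d)"
proof -
  have ric: "((\<lambda>\<gamma>. ricci (g \<gamma>) b d x) has_real_derivative 0) (at 0)" for b d
    using DERIV_sum[of UNIV "\<lambda>\<gamma> a. riemann_up (g \<gamma>) a b a d x" "\<lambda>a. R a b a d", OF R]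
    by (simp add: ricci_def vac)
  have ric0: "ricci (g 0) b d x = 0" for b d
    by (simp add: ricci_def flat)
  have mult_ric: "((\<lambda>\<gamma>. F \<gamma> * ricci (g \<gamma>) b d x) has_real_derivative 0) (at 0)"
    if "isCont F 0" for F b d
    using has_real_derivative_mult_zero[OF that ric ric0] by simp
  have scal: "((\<lambda>\<gamma>. scalar_curv (g \<gamma>) x) has_real_derivative 0) (at 0)"
  proof -
    have "((\<lambda>\<gamma>. scalar_curv (g \<gamma>) x) has_real_derivative
        (\<Sum>a\<in>(UNIV :: 4 set). \<Sum>b\<in>(UNIV :: 4 set). 0)) (at 0)"
      unfolding scalar_curv_def by (intro DERIV_sum mult_ric cont)
    then show ?thesis by simp
  qed
  have scal0: "scalar_curv (g 0) x = 0"
    by (simp add: scalar_curv_def ric0)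
  have Riem: "((\<lambda>\<gamma>. riemann (g \<gamma>) a b c d x) has_real_derivative
      (\<Sum>e\<in>UNIV. g 0 x $ a $ e * R e b c d)) (at 0)"
    unfolding riemann_def by (intro DERIV_sum has_real_derivative_mult_zero cont R flat)
  have ricci_part: "((\<lambda>\<gamma>. antisym_part (\<lambda>c d. g \<gamma> x $ a $ c * ricci (g \<gamma>) d b x) c d)
      has_real_derivative 0) (at 0)" for a b
    using DERIV_cdivide[OF DERIV_diff[OF mult_ric mult_ric, OF cont(1) cont(1)]]
    by (simp add: antisym_part_def)
  have "isCont (\<lambda>\<gamma>. antisym_part (\<lambda>c d. g \<gamma> x $ a $ c * g \<gamma> x $ d $ b) c d / 3) 0"
    unfolding antisym_part_def by (intro continuous_intros cont) simp_all
  from has_real_derivative_mult_zero[OF this scal scal0]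
  have "((\<lambda>\<gamma>. scalar_curv (g \<gamma>) x / 3 * antisym_part (\<lambda>c d. g \<gamma> x $ a $ c * g \<gamma> x $ d $ b) c d)
      has_real_derivative 0) (at 0)"
    by (simp add: mult.commute)
  from DERIV_add[OF DERIV_diff[OF Riem DERIV_diff[OF ricci_part ricci_part]] this]
  have "((\<lambda>\<gamma>. weyl (g \<gamma>) a b c d x) has_real_derivative
      (\<Sum>e\<in>UNIV. g 0 x $ a $ e * R e b c d)) (at 0)"
    by (simp add: weyl_def)
  then show ?thesis
    unfolding weyl1_def by (rule DERIV_imp_deriv)
qed

section \<open>The counterexample\<close>

text \<open>With \<open>u = z - t\<close> and \<open>w = z + t\<close> the Minkowski metric is \<open>du dw + dx\<^sup>2 + dy\<^sup>2\<close>. The components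
  \<open>l_up\<close> are both those of the vector \<open>\<partial>\<^sub>t + \<partial>\<^sub>z = 2 \<partial>\<^sub>w\<close> and those of the covector \<open>dw\<close>.\<close>

definition l_up :: "4 \<Rightarrow> real" where "l_up a = (if a = 0 \<or> a = 3 then 1 else 0)"
definition du :: "4 \<Rightarrow> real" where "du a = (if a = 0 then -1 else if a = 3 then 1 else 0)"
definition dx :: "4 \<Rightarrow> real" where "dx a = (if a = 1 then 1 else 0)"

text \<open>The components of dx^2 + dy^2, the metric of the plane orthogonal to both null
  directions.\<close>

definition screen :: "4 \<Rightarrow> 4 \<Rightarrow> real" where
  "screen a b = (if a = b \<and> (a = 1 \<or> a = 2) then 1 else 0)"

definition w_coord :: "real^4 \<Rightarrow> real" where "w_coord x = x $ 0 + x $ 3"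

text \<open>The ratio 4 : 1 of the two coefficients is what cancels the wx component of the
  linearized Ricci tensor.\<close>

definition pert :: "4 \<Rightarrow> 4 \<Rightarrow> real^4 \<Rightarrow> real" where
  "pert a b x = 4 * (w_coord x * x $ 1) * screen a b + (w_coord x)\<^sup>2 * (du a * dx b + dx a * du b)"

text \<open>\<open>dpert c a b\<close> is the partial derivative \<open>\<partial>\<^sub>c\<close> of \<open>pert a b\<close>.\<close>

definition dpert :: "4 \<Rightarrow> 4 \<Rightarrow> 4 \<Rightarrow> real^4 \<Rightarrow> real" where
  "dpert c a b x = 4 * (l_up c * x $ 1 + w_coord x * dx c) * screen a b
     + 2 * w_coord x * l_up c * (du a * dx b + dx a * du b)"

definition gs_metric :: "real \<Rightarrow> real^4 \<Rightarrow> real^4^4" where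
  "gs_metric \<gamma> x = (\<chi> a b. minkowski $ a $ b + \<gamma> * pert a b x)"

definition screen_factor :: "real \<Rightarrow> real^4 \<Rightarrow> real" where
  "screen_factor \<gamma> x = 1 + 4 * \<gamma> * (w_coord x * x $ 1)"

text \<open>The inverse metric. It comes from completing the square in the metric, which gives
  \<open>E (dx + B/E du)\<^sup>2 + E dy\<^sup>2 + du (dw - B\<^sup>2/E du)\<close> with \<open>E = screen_factor \<gamma>\<close> and \<open>B = \<gamma> w\<^sup>2\<close>.\<close>

definition ginv :: "real \<Rightarrow> 4 \<Rightarrow> 4 \<Rightarrow> real^4 \<Rightarrow> real" where
  "ginv \<gamma> a b x = minkowski $ a $ b - screen a b + screen a b / screen_factor \<gamma> x
     - \<gamma> * (w_coord x)\<^sup>2 / screen_factor \<gamma> x * (l_up a * dx b + dx a * l_up b)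
     + (\<gamma> * (w_coord x)\<^sup>2)\<^sup>2 / screen_factor \<gamma> x * (l_up a * l_up b)"

text \<open>Quotient rule in the direction \<open>v\<close>: the first summand differentiates the
  numerators, the second the common denominator \<open>screen_factor\<close>.\<close>

definition dginv :: "real \<Rightarrow> 4 \<Rightarrow> 4 \<Rightarrow> real^4 \<Rightarrow> real^4 \<Rightarrow> real" where
  "dginv \<gamma> a b x v =
     \<gamma> * (2 * w_coord x * w_coord v) / screen_factor \<gamma> x
       * (2 * (\<gamma> * (w_coord x)\<^sup>2) * (l_up a * l_up b) - (l_up a * dx b + dx a * l_up b))
     - 4 * \<gamma> * (w_coord v * x $ 1 + w_coord x * v $ 1) / (screen_factor \<gamma> x)\<^sup>2 * (screen a b
       - \<gamma> * (w_coord x)\<^sup>2 * (l_up a * dx b + dx a * l_up b) + (\<gamma> * (w_coord x)\<^sup>2)\<^sup>2 * (l_up a * l_up b))"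

definition l_field :: "real^4" where "l_field = (\<chi> a. l_up a)"

text \<open>The bound keeps \<open>screen_factor \<gamma>\<close> positive for all \<gamma> between
  -1 and 1, so one region serves the whole family.\<close>

definition region :: "(real^4) set" where "region = {x. \<bar>4 * (w_coord x * x $ 1)\<bar> < 1}"

lemmas component_defs = l_up_def du_def dx_def screen_def

section \<open>Coordinate functions and the region\<close>

lemma bounded_linear_w_coord: "bounded_linear w_coord"
  unfolding w_coord_def[abs_def] by (intro bounded_linear_add bounded_linear_vec_nth)

lemma w_coord_has_derivative [derivative_intros]: "(w_coord has_derivative w_coord) (at x)"
  by (rule bounded_linear_imp_has_derivative[OF bounded_linear_w_coord])

lemma vec_nth_has_derivative: "((\<lambda>y. y $ i) has_derivative (\<lambda>y. y $ i)) (at x)"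
  by (rule bounded_linear_imp_has_derivative[OF bounded_linear_vec_nth])

lemma w_coord_axis: "w_coord (axis c 1) = l_up c"
  by (simp add: w_coord_def axis_def l_up_def)

lemma nth_1_axis: "(axis c 1 :: real^4) $ 1 = dx c"
  by (simp add: axis_def dx_def)

lemma open_region: "open region"
proof -
  have "continuous_on UNIV (\<lambda>x. \<bar>4 * (w_coord x * x $ 1)\<bar>)"
    unfolding w_coord_def by (intro continuous_intros)
  then show ?thesis
    unfolding region_def by (rule open_Collect_less) simp
qed

lemma screen_factor_pos:
  assumes "\<gamma> \<in> {-1<..<1}" "x \<in> region"
  shows "screen_factor \<gamma> x > 0"
proof -
  define q where "q = 4 * (w_coord x * x $ 1)"
  have "\<bar>\<gamma> * q\<bar> \<le> 1 * \<bar>q\<bar>"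
    unfolding abs_mult using assms(1) by (intro mult_right_mono) auto
  moreover have "\<bar>q\<bar> < 1" "screen_factor \<gamma> x = 1 + \<gamma> * q"
    using assms(2) by (auto simp: region_def screen_factor_def q_def)
  ultimately show ?thesis by linarith
qed

section \<open>First derivatives, inverse and signature of the metric\<close>

lemma gs_metric_nth: "gs_metric \<gamma> x $ a $ b = minkowski $ a $ b + \<gamma> * pert a b x"
  by (simp add: gs_metric_def)

lemma gs_metric_sym: "gs_metric \<gamma> x $ a $ b = gs_metric \<gamma> x $ b $ a"
  by (simp add: gs_metric_def minkowski_def pert_def screen_def algebra_simps)

lemma pert_has_derivative:
  "(pert a b has_derivative (\<lambda>v. 4 * (w_coord v * x $ 1 + w_coord x * v $ 1) * screen a b
     + 2 * w_coord x * w_coord v * (du a * dx b + dx a * du b))) (at x)"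
  unfolding pert_def[abs_def]
  by (auto intro!: derivative_eq_intros vec_nth_has_derivative simp: algebra_simps)

lemma gs_metric_has_derivative:
  "((\<lambda>y. gs_metric \<gamma> y $ a $ b) has_derivative
     (\<lambda>v. \<gamma> * (4 * (w_coord v * x $ 1 + w_coord x * v $ 1) * screen a b
       + 2 * w_coord x * w_coord v * (du a * dx b + dx a * du b)))) (at x)"
  unfolding gs_metric_nth by (auto intro!: derivative_eq_intros pert_has_derivative)

lemma pd_gs_metric: "pd c (\<lambda>y. gs_metric \<gamma> y $ a $ b) x = \<gamma> * dpert c a b x"
  unfolding pd_eqI[OF gs_metric_has_derivative] by (simp add: dpert_def w_coord_axis nth_1_axis)

lemma gs_metric_differentiable: "(\<lambda>y. gs_metric \<gamma> y $ a $ b) differentiable (at x)"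
  using gs_metric_has_derivative unfolding differentiable_def by blast

text \<open>Writing the Minkowski metric as du dw plus \<open>screen\<close> merges the transverse
  parts into one conformal factor; inverse, frame and shear are read off from this form.\<close>

lemma gs_metric_null_frame:
  "gs_metric \<gamma> x $ a $ b = (du a * l_up b + l_up a * du b) / 2 + screen_factor \<gamma> x * screen a b
     + \<gamma> * (w_coord x)\<^sup>2 * (du a * dx b + dx a * du b)"
  using exhaust_4[of a] exhaust_4[of b]
  by (auto simp: gs_metric_nth minkowski_def pert_def screen_factor_def component_defs algebra_simps)

lemma inv_metric_gs_metric:
  assumes "screen_factor \<gamma> x \<noteq> 0"
  shows "inv_metric (gs_metric \<gamma>) a b x = ginv \<gamma> a b x"
proof -
  have "gs_metric \<gamma> x ** (\<chi> a b. ginv \<gamma> a b x) = mat 1"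
    using assms
    by (simp add: vec_eq_iff forall_4_from_0 matrix_matrix_mult_def sum_4_from_0 mat_def
        gs_metric_null_frame minkowski_def ginv_def component_defs)
      (simp add: field_simps power2_eq_square)
  then show ?thesis
    by (simp add: inv_metric_def matrix_inv_eqI)
qed

lemma lorentzian_gs_metric:
  assumes "screen_factor \<gamma> x > 0"
  shows "lorentzian (gs_metric \<gamma> x)"
proof -
  define B where "B = \<gamma> * (w_coord x)\<^sup>2"
  define e where "e = sqrt (screen_factor \<gamma> x)"
  have e: "e > 0" "screen_factor \<gamma> x = e * e" using assms by (auto simp: e_def)
  \<comment> \<open>The frame dual to the completed square: columns 0 and 3 are the t and z
    directions tilted by \<open>B\<close>, and columns 1 and 2 are the x and y directions divided by
    \<open>e\<close>.\<close>
  define P :: "real^4^4" where "P = (\<chi> a b.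
    if b = 0 then (if a = 0 then 1 - B\<^sup>2 / (2 * e\<^sup>2) else if a = 1 then B / e\<^sup>2
      else if a = 3 then - B\<^sup>2 / (2 * e\<^sup>2) else 0)
    else if b = 3 then (if a = 0 then B\<^sup>2 / (2 * e\<^sup>2) else if a = 1 then - B / e\<^sup>2
      else if a = 3 then 1 + B\<^sup>2 / (2 * e\<^sup>2) else 0)
    else screen a b / e)"
  have P: "transpose P ** gs_metric \<gamma> x ** P = minkowski"
    using e(1)
    by (simp add: vec_eq_iff forall_4_from_0 matrix_matrix_mult_def sum_4_from_0 transpose_def
        gs_metric_null_frame e(2) minkowski_def P_def B_def component_defs)
      (simp add: field_simps power2_eq_square)
  \<comment> \<open>By \<open>P\<close> this determinant has \<open>det P\<close> as a factor, so it
    being nonzero makes \<open>P\<close> invertible.\<close>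
  have "det minkowski \<noteq> 0"
  proof -
    have "minkowski ** minkowski = mat 1"
      by (simp add: vec_eq_iff forall_4_from_0 matrix_matrix_mult_def sum_4_from_0 mat_def minkowski_def)
    then show ?thesis by (metis det_I det_mul mult_zero_left zero_neq_one)
  qed
  then have "invertible P"
    unfolding invertible_det_nz P[symmetric] by (auto simp: det_mul)
  moreover have "transpose (gs_metric \<gamma> x) = gs_metric \<gamma> x"
    by (simp add: vec_eq_iff transpose_def gs_metric_sym)
  ultimately show ?thesis
    using P by (auto simp: lorentzian_def)
qed

section \<open>The congruence is null, geodesic and shear-free\<close>

lemma lower_gs_metric: "lower (gs_metric \<gamma>) (\<lambda>_. l_field) x = (\<chi> a. du a)"
  \<comment> \<open>\<open>du\<close>, \<open>dx\<close> and \<open>screen\<close> all annihilate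
    \<open>l_field\<close>, hence so does the perturbation, and the index is lowered as in flat
    space.\<close>
  by (simp add: vec_eq_iff lower_def l_field_def forall_4_from_0 sum_4_from_0 gs_metric_nth
      minkowski_def pert_def component_defs)

lemma null_on_gs_metric: "null_on U (gs_metric \<gamma>) (\<lambda>_. l_field)"
  by (simp add: null_on_def l_field_def sum_4_from_0 gs_metric_nth
      minkowski_def pert_def component_defs)

lemma geodesic_on_gs_metric: "geodesic_on region (gs_metric \<gamma>) (\<lambda>_. l_field)"
  by (rule geodesic_on_const[OF open_region gs_metric_sym gs_metric_differentiable lower_gs_metric])

text \<open>Half the Lie derivative of the metric consists of a \<open>screen\<close> part and a
  part symmetrized with \<open>du\<close>, the lowered \<open>l_field\<close>. The former is
  absorbed by \<theta>, the latter by \<open>J\<close>.\<close>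

lemma shear_free_on_gs_metric:
  assumes "\<gamma> \<in> {-1<..<1}"
  shows "shear_free_on region (gs_metric \<gamma>) (\<lambda>_. l_field)"
proof -
  \<comment> \<open>Chosen to match the \<open>screen\<close> coefficients on both sides.\<close>
  define \<theta> where "\<theta> x = 4 * \<gamma> * x $ 1 / screen_factor \<gamma> x" for x
  \<comment> \<open>The \<open>dx\<close> part corrects the du dx terms; the \<open>l_up\<close>
    part removes the du dw term that \<theta> times the metric brings in.\<close>
  define J :: "real^4 \<Rightarrow> real^4"
    where "J x = (\<chi> a. (4 * \<gamma> * w_coord x - 2 * \<theta> x * (\<gamma> * (w_coord x)\<^sup>2)) * dx a - \<theta> x * l_up a)" for x
  have rational: "rational_on region (screen_factor \<gamma>)"
    unfolding screen_factor_def[abs_def]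
    by (intro rational_on.add rational_on.mult rational_on.const rational_on.linear
        bounded_linear_w_coord bounded_linear_vec_nth)
  then have \<theta>: "rational_on region \<theta>"
    unfolding \<theta>_def[abs_def] using screen_factor_pos[OF assms]
    by (intro rational_on_divide[OF _ rational] rational_on.mult rational_on.const rational_on.linear
        bounded_linear_vec_nth) force
  then have "smooth_on region \<theta>"
    by (intro smooth_on_rational open_region) simp
  moreover have "smooth_on region J"
  proof (rule smooth_on_rational[OF open_region])
    fix b :: "real^4" assume "b \<in> Basis"
    then obtain i where "b = axis i 1" by (auto simp: Basis_vec_def)
    then have "(\<lambda>x. J x \<bullet> b)
        = (\<lambda>x. (4 * \<gamma> * w_coord x - 2 * \<theta> x * (\<gamma> * (w_coord x)\<^sup>2)) * dx i - \<theta> x * l_up i)"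
      by (simp add: J_def inner_axis)
    then show "rational_on region (\<lambda>x. J x \<bullet> b)"
      using \<theta> by (simp add: rational_on_diff rational_on_power rational_on.mult rational_on.const
         rational_on.linear bounded_linear_w_coord)
  qed
  moreover have "sym_part (\<lambda>a b. nabla_covec (gs_metric \<gamma>) (lower (gs_metric \<gamma>) (\<lambda>_. l_field)) a b x) a b
      = sym_part (\<lambda>a b. J x $ a * lower (gs_metric \<gamma>) (\<lambda>_. l_field) x $ b) a b + \<theta> x * gs_metric \<gamma> x $ a $ b"
    if "x \<in> region" for x a b
  proof -
    have pos: "screen_factor \<gamma> x > 0" using screen_factor_pos assms that by blast
    then have *: "\<theta> x * screen_factor \<gamma> x = 4 * \<gamma> * x $ 1" by (simp add: \<theta>_def)
    have "sym_part (\<lambda>a b. nabla_covec (gs_metric \<gamma>) (lower (gs_metric \<gamma>) (\<lambda>_. l_field)) a b x) a b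
       = \<gamma> * (4 * x $ 1 * screen a b + 2 * w_coord x * (du a * dx b + dx a * du b))"
      using sym_nabla_lower_const[OF open_region that
          lorentzian_invertible[OF lorentzian_gs_metric[OF pos]] gs_metric_sym gs_metric_differentiable, of l_field a b]
      by (simp add: pd_gs_metric sum_4_from_0 l_field_def dpert_def l_up_def dx_def algebra_simps)
    also have "\<dots> = sym_part (\<lambda>a b. J x $ a * du b) a b + \<theta> x * gs_metric \<gamma> x $ a $ b"
    proof -
      have "\<theta> x * gs_metric \<gamma> x $ a $ b = \<theta> x * (du a * l_up b + l_up a * du b) / 2
        + 4 * \<gamma> * x $ 1 * screen a b + \<theta> x * (\<gamma> * (w_coord x)\<^sup>2) * (du a * dx b + dx a * du b)"
        unfolding gs_metric_null_frame *[symmetric] by (simp add: algebra_simps)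
      then show ?thesis
        by (simp add: sym_part_def J_def field_simps)
    qed
    finally show ?thesis by (simp add: lower_gs_metric)
  qed
  ultimately show ?thesis unfolding shear_free_on_def by blast
qed

section \<open>Joint smoothness in the parameter and the point\<close>

lemma smooth_on_gs_metric: "smooth_on ({-1<..<1} \<times> region) (\<lambda>(\<gamma>, x). gs_metric \<gamma> x)"
proof (rule smooth_on_rational)
  show "open ({-1<..<1::real} \<times> region)" by (intro open_Times open_region) simp
  fix b :: "real^4^4" assume "b \<in> Basis"
  then obtain i j where "b = axis i (axis j 1)" by (auto simp: Basis_vec_def)
  then have *: "(\<lambda>x. (case x of (\<gamma>, x) \<Rightarrow> gs_metric \<gamma> x) \<bullet> b)
      = (\<lambda>z. minkowski $ i $ j + fst z * pert i j (snd z))"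
    by (simp add: fun_eq_iff inner_axis gs_metric_nth)
  show "rational_on ({-1<..<1} \<times> region) (\<lambda>x. (case x of (\<gamma>, x) \<Rightarrow> gs_metric \<gamma> x) \<bullet> b)"
    unfolding * pert_def
    by (intro rational_on.add rational_on.mult rational_on_power rational_on.const
       rational_on.linear bounded_linear_fst bounded_linear_compose[OF bounded_linear_w_coord bounded_linear_snd]
       bounded_linear_compose[OF bounded_linear_vec_nth bounded_linear_snd])
qed

section \<open>Derivatives of the inverse metric and of the connection\<close>

lemma screen_factor_has_derivative:
  "(screen_factor \<gamma> has_derivative (\<lambda>v. 4 * \<gamma> * (w_coord v * x $ 1 + w_coord x * v $ 1))) (at x)"
  unfolding screen_factor_def[abs_def]
  by (auto intro!: derivative_eq_intros vec_nth_has_derivative simp: algebra_simps)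

lemma ginv_has_derivative:
  assumes "screen_factor \<gamma> x \<noteq> 0"
  shows "(ginv \<gamma> a b has_derivative dginv \<gamma> a b x) (at x)"
  unfolding ginv_def[abs_def] dginv_def
  by (rule derivative_eq_intros refl screen_factor_has_derivative w_coord_has_derivative assms | simp)+
    (use assms in \<open>simp add: fun_eq_iff field_simps power2_eq_square\<close>)

text \<open>\<open>pert\<close> is quadratic, so \<open>ddpert c a b v\<close>, the derivative of \<open>dpert c a b\<close> in the direction \<open>v\<close>,
  does not depend on the point.\<close>

definition ddpert :: "4 \<Rightarrow> 4 \<Rightarrow> 4 \<Rightarrow> real^4 \<Rightarrow> real" where
  "ddpert c a b v = 4 * (l_up c * v $ 1 + w_coord v * dx c) * screen a b
     + 2 * w_coord v * l_up c * (du a * dx b + dx a * du b)"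

lemma dpert_has_derivative: "(dpert c a b has_derivative ddpert c a b) (at x)"
  unfolding dpert_def[abs_def] ddpert_def[abs_def]
  by (auto intro!: derivative_eq_intros vec_nth_has_derivative simp: algebra_simps)

text \<open>The Christoffel symbols with one factor \<gamma> removed; what remains depends on
  \<gamma> through \<open>ginv\<close>.\<close>

definition conn :: "real \<Rightarrow> 4 \<Rightarrow> 4 \<Rightarrow> 4 \<Rightarrow> real^4 \<Rightarrow> real" where
  "conn \<gamma> a b c x
     = (\<Sum>d\<in>UNIV. ginv \<gamma> a d x * ((dpert b d c x + dpert c d b x - dpert d b c x) / 2))"

definition dconn :: "real \<Rightarrow> 4 \<Rightarrow> 4 \<Rightarrow> 4 \<Rightarrow> real^4 \<Rightarrow> real^4 \<Rightarrow> real" where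
  "dconn \<gamma> a b c x v
     = (\<Sum>d\<in>UNIV. ginv \<gamma> a d x * ((ddpert b d c v + ddpert c d b v - ddpert d b c v) / 2)
         + dginv \<gamma> a d x v * ((dpert b d c x + dpert c d b x - dpert d b c x) / 2))"

lemma christoffel_gs_metric:
  assumes "screen_factor \<gamma> x \<noteq> 0"
  shows "christoffel (gs_metric \<gamma>) a b c x = \<gamma> * conn \<gamma> a b c x"
  by (simp add: christoffel_def conn_def inv_metric_gs_metric[OF assms] pd_gs_metric sum_distrib_left
      add_divide_distrib diff_divide_distrib algebra_simps)

lemma conn_has_derivative:
  assumes "screen_factor \<gamma> x \<noteq> 0"
  shows "(conn \<gamma> a b c has_derivative dconn \<gamma> a b c x) (at x)"
  unfolding conn_def[abs_def] dconn_def[abs_def]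
  by (intro has_derivative_sum has_derivative_mult has_derivative_add
      bounded_linear.has_derivative[OF bounded_linear_divide]
      has_derivative_diff ginv_has_derivative dpert_has_derivative assms)

section \<open>Linearized curvature\<close>

lemma screen_factor_0 [simp]: "screen_factor 0 x = 1"
  by (simp add: screen_factor_def)

lemma ginv_0: "ginv 0 a b x = minkowski $ a $ b"
  by (simp add: ginv_def)

lemma dginv_0: "dginv 0 a b x v = 0"
  by (simp add: dginv_def)

lemma sum_minkowski: "(\<Sum>d\<in>UNIV. minkowski $ a $ d * f d) = minkowski $ a $ a * f a"
  by (simp add: minkowski_def if_distrib[where f="\<lambda>t. t * _"] cong: if_cong)

lemma isCont_ginv: "isCont (\<lambda>\<gamma>. ginv \<gamma> a b x) 0"
  unfolding ginv_def screen_factor_def by (intro continuous_intros) simp_all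

lemma isCont_dginv: "isCont (\<lambda>\<gamma>. dginv \<gamma> a b x v) 0"
  unfolding dginv_def screen_factor_def by (intro continuous_intros) simp_all

text \<open>The linearized Riemann tensor with first index up, built from second derivatives of
  \<open>pert\<close> and hence constant. The diagonal Minkowski metric raises the index by a mere
  sign.\<close>

definition lin_riem :: "4 \<Rightarrow> 4 \<Rightarrow> 4 \<Rightarrow> 4 \<Rightarrow> real" where
  "lin_riem a b c d = minkowski $ a $ a / 2 *
     (ddpert b a d (axis c 1) + ddpert d a b (axis c 1) - ddpert a d b (axis c 1)
      - ddpert b a c (axis d 1) - ddpert c a b (axis d 1) + ddpert a c b (axis d 1))"

lemma gs_metric_riemann_up_derivative:
  assumes "x \<in> region"
  shows "((\<lambda>\<gamma>. riemann_up (gs_metric \<gamma>) a b c d x) has_real_derivative lin_riem a b c d) (at 0)"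
proof -
  have "((\<lambda>\<gamma>. riemann_up (gs_metric \<gamma>) a b c d x) has_real_derivative
      dconn 0 a d b x (axis c 1) - dconn 0 a c b x (axis d 1)) (at 0)"
  proof (rule has_real_derivative_riemann_up[OF open_region assms, of "{-1<..<1}"])
    show "christoffel (gs_metric \<gamma>) a b c y = \<gamma> * conn \<gamma> a b c y"
      if "\<gamma> \<in> {-1<..<1}" "y \<in> region" for \<gamma> y a b c
      using screen_factor_pos[OF that] by (intro christoffel_gs_metric) simp
    show "(conn \<gamma> a b c has_derivative dconn \<gamma> a b c x) (at x)" if "\<gamma> \<in> {-1<..<1}" for \<gamma> a b c
      using screen_factor_pos[OF that assms] by (intro conn_has_derivative) simp
    show "isCont (\<lambda>\<gamma>. conn \<gamma> a b c x) 0" for a b c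
      unfolding conn_def by (intro continuous_intros isCont_ginv)
    show "isCont (\<lambda>\<gamma>. dconn \<gamma> a b c x v) 0" for a b c v
      unfolding dconn_def by (intro continuous_intros isCont_ginv isCont_dginv)
  qed simp_all
  \<comment> \<open>At \<gamma> = 0 the inverse metric is constant, so its derivative contributes
    nothing and the sum over \<open>d\<close> collapses.\<close>
  moreover have "dconn 0 a b c x v
      = minkowski $ a $ a * ((ddpert b a c v + ddpert c a b v - ddpert a b c v) / 2)" for a b c v
    by (simp only: dconn_def ginv_0 dginv_0 mult_zero_left add_0_right sum_minkowski)
  ultimately show ?thesis
    by (simp add: lin_riem_def add_divide_distrib diff_divide_distrib algebra_simps)
qed

lemma lin_riem_ricci_flat: "(\<Sum>a\<in>UNIV. lin_riem a b a d) = 0"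
proof -
  have "\<forall>b d. (\<Sum>a\<in>UNIV. lin_riem a b a d) = 0"
    unfolding forall_4_from_0 sum_4_from_0 lin_riem_def ddpert_def w_coord_axis nth_1_axis
    by (simp add: component_defs minkowski_def)
  then show ?thesis by blast
qed

lemma ricci1_gs_metric:
  assumes "x \<in> region"
  shows "ricci1 gs_metric b d x = 0"
proof -
  have "((\<lambda>\<gamma>. ricci (gs_metric \<gamma>) b d x) has_real_derivative (\<Sum>a\<in>UNIV. lin_riem a b a d)) (at 0)"
    unfolding ricci_def by (intro DERIV_sum gs_metric_riemann_up_derivative assms)
  then show ?thesis
    unfolding ricci1_def lin_riem_ricci_flat by (rule DERIV_imp_deriv)
qed

lemma gs_metric_0: "gs_metric 0 x = minkowski"
  by (simp add: vec_eq_iff gs_metric_nth)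

lemma weyl1_gs_metric:
  assumes "x \<in> region"
  shows "weyl1 gs_metric a b c d x = minkowski $ a $ a * lin_riem a b c d"
proof -
  have "weyl1 gs_metric a b c d x = (\<Sum>e\<in>UNIV. gs_metric 0 x $ a $ e * lin_riem e b c d)"
  proof (rule weyl1_linearized_vacuum[OF gs_metric_riemann_up_derivative[OF assms] _ lin_riem_ricci_flat])
    have "christoffel (gs_metric 0) a b c = (\<lambda>x. 0)" for a b c
      by (rule ext) (simp add: christoffel_gs_metric)
    then show "riemann_up (gs_metric 0) a b c d x = 0" for a b c d
      by (simp add: riemann_up_def pd_def)
    show "isCont (\<lambda>\<gamma>. gs_metric \<gamma> x $ a $ b) 0" for a b
      unfolding gs_metric_nth by (intro continuous_intros)
    \<comment> \<open>\<open>ginv\<close> is known to invert the metric only where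
      \<open>screen_factor\<close> is nonzero, so the two are compared near \<gamma> = 0
      only.\<close>
    have "\<forall>\<^sub>F \<gamma> in nhds 0. \<gamma> \<in> {-1<..<1::real}"
      by (rule eventually_nhds_in_open) simp_all
    then have "\<forall>\<^sub>F \<gamma> in nhds 0. inv_metric (gs_metric \<gamma>) a b x = ginv \<gamma> a b x" for a b
      by eventually_elim (use screen_factor_pos[OF _ assms] in \<open>force intro: inv_metric_gs_metric\<close>)
    then show "isCont (\<lambda>\<gamma>. inv_metric (gs_metric \<gamma>) a b x) 0" for a b
      by (rule isCont_cong[THEN iffD2, OF _ isCont_ginv])
  qed
  also have "\<dots> = minkowski $ a $ a * lin_riem a b c d"
    by (simp add: gs_metric_0 sum_minkowski)
  finally show ?thesis .
qed

lemma zero_in_region: "0 \<in> region"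
  by (simp add: region_def)

text \<open>As the lowered \<open>l_field\<close> has components -1 and 0 at the indices 0 and 1,
  this is -1/2 times the Weyl tensor on (\<open>\<partial>_t\<close>, l, l,
  \<open>\<partial>_x\<close>). With \<open>\<partial>_t = \<partial>_w - \<partial>_u\<close> it
  reduces to the uwwx component, half the second w-derivative of w^2.\<close>

lemma C1_degeneracy_gs_metric: "C1_degeneracy gs_metric (\<lambda>_. l_field) 0 1 0 0 \<noteq> 0"
  by (simp add: C1_degeneracy_def antisym_part_def lower_def weyl1_gs_metric[OF zero_in_region] sum_4_from_0
      lin_riem_def ddpert_def w_coord_axis nth_1_axis l_field_def)
   (simp add: component_defs minkowski_def)

lemma l_field_nonzero: "l_field \<noteq> 0"
  by (simp add: vec_eq_iff l_field_def forall_4_from_0 l_up_def)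

theorem mainTheorem1:
  shows "\<exists>(U :: (real^4) set) (I :: real set) (g :: real \<Rightarrow> real^4 \<Rightarrow> real^4^4) (l :: real^4 \<Rightarrow> real^4).
    open U \<and> U \<noteq> {} \<and>
    open I \<and> is_interval I \<and> 0 \<in> I \<and>
    smooth_on (I \<times> U) (\<lambda>(\<gamma>, x). g \<gamma> x) \<and>
    (\<forall>\<gamma>\<in>I. \<forall>x\<in>U. lorentzian (g \<gamma> x)) \<and>
    (\<forall>x\<in>U. g 0 x = minkowski) \<and>
    smooth_on U l \<and> (\<forall>x\<in>U. l x \<noteq> 0) \<and>
    (\<forall>\<gamma>\<in>I. null_on U (g \<gamma>) l \<and> geodesic_on U (g \<gamma>) l \<and> shear_free_on U (g \<gamma>) l) \<and>
    (\<forall>x\<in>U. \<forall>a b. ricci1 g a b x = 0) \<and>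
    \<not> (\<forall>x\<in>U. \<forall>a d e. C1_degeneracy g l a d e x = 0)"
proof (intro exI[of _ region] exI[of _ "{-1<..<1}"] exI[of _ gs_metric] exI[of _ "\<lambda>_. l_field"] conjI)
  show "smooth_on region (\<lambda>_. l_field)"
    by (intro smooth_on_rational open_region rational_on.const)
  show "\<not> (\<forall>x\<in>region. \<forall>a d e. C1_degeneracy gs_metric (\<lambda>_. l_field) a d e x = 0)"
    using zero_in_region C1_degeneracy_gs_metric by blast
qed (use zero_in_region in \<open>auto simp: open_region smooth_on_gs_metric lorentzian_gs_metric
    screen_factor_pos gs_metric_0 l_field_nonzero null_on_gs_metric
    geodesic_on_gs_metric shear_free_on_gs_metric ricci1_gs_metric\<close>)

end
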